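(* Let $X$ be a set with at least two elements, $\Gamma$ a nonempty set, $\varphi:\Gamma\to\Gamma$ a map, and let $\sigma_\varphi:X^\Gamma\to X^\Gamma$, $\sigma_\varphi((x_\alpha)_{\alpha\in\Gamma})=(x_{\varphi(\alpha)})_{\alpha\in\Gamma}$, be the generalized shift. Let $\Re$ be the equivalence relation on $\Gamma$ given by $\alpha\Re\beta$ if and only if there exists $n\geq1$ with $\varphi^n(\alpha)=\varphi^n(\beta)$, and let $\widetilde{\varphi}:\frac{\Gamma}{\Re}\to\frac{\Gamma}{\Re}$ be the induced map $[\alpha]_\Re\mapsto[\varphi(\alpha)]_\Re$, with generalized shift $\sigma_{\widetilde{\varphi}}:X^{\frac{\Gamma}{\Re}}\to X^{\frac{\Gamma}{\Re}}$. If $\sigma_\varphi$ is finite fibre, then $$\mathrm{ent}_{\rm cset}(\sigma_\varphi)=\mathrm{ent}_{\rm cset}(\sigma_{\widetilde{\varphi}})=\begin{cases}0 & \text{if there exists } n\geq1 \text{ with } (\widetilde{\varphi})^n=\mathrm{id}_{\frac{\Gamma}{\Re}},\\ \infty & \text{otherwise}.\end{cases}$$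
   Context: For any nonempty set $\Lambda$ and map $\psi:\Lambda\to\Lambda$, the generalized shift is $\sigma_\psi:X^\Lambda\to X^\Lambda$, $\sigma_\psi((x_\lambda)_{\lambda\in\Lambda})=(x_{\psi(\lambda)})_{\lambda\in\Lambda}$. A self-map $k:A\to A$ is finite fibre if $k^{-1}(a)$ is finite for all $a\in A$. If $g:A\to A$ is onto and finite fibre, then for finite $D\subseteq A$ put $\mathrm{ent}_{\rm cset}(g,D)=\lim_{n\to\infty}\frac{|D\cup g^{-1}(D)\cup\cdots\cup g^{-(n-1)}(D)|}{n}$ (the limit exists) and $\mathrm{ent}_{\rm cset}(g)=\sup\{\mathrm{ent}_{\rm cset}(g,D):D\text{ a finite subset of }A\}$. For an arbitrary finite fibre map $k:A\to A$, let $\mathrm{sc}(k)=\bigcap\{k^n(A):n\geq1\}$ (the surjective cover); then $k\restriction_{\mathrm{sc}(k)}:\mathrm{sc}(k)\to\mathrm{sc}(k)$ is onto and finite fibre, and the contravariant set-theoretical entropy of $k$ is $\mathrm{ent}_{\rm cset}(k):=\mathrm{ent}_{\rm cset}(k\restriction_{\mathrm{sc}(k)})$. It is known that $\mathrm{ent}_{\rm cset}(k)=\mathfrak{a}(k)$, where $\mathfrak{a}(k)=\sup(\{0\}\cup\{j\geq1:$ there exist $j$ pairwise disjoint infinite anti-orbit sequences of $k\})$; an anti-orbit sequence of $k$ is a sequence $\{x_n\}_{n\geq1}$ in $A$ with $k(x_{n+1})=x_n$ for all $n\geq1$, it is infinite if $\{x_n:n\geq1\}$ is an infinite set, and disjointness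 refers to the sets of terms. *)

theory Defs
  imports "HOL-Analysis.Analysis"
begin

text \<open>
  The set \<open>X\<^sup>\<Lambda>\<close> is \<open>\<Lambda> \<rightarrow>\<^sub>E X\<close>. The index set is a set rather than a type because the
  quotient \<open>\<Gamma> // shift_rel \<Gamma> \<phi>\<close> has to serve as an index set as well.
\<close>

definition gen_shift :: "'i set \<Rightarrow> ('i \<Rightarrow> 'i) \<Rightarrow> ('i \<Rightarrow> 'x) \<Rightarrow> ('i \<Rightarrow> 'x)" where
  "gen_shift \<Lambda> \<psi> x = (\<lambda>i\<in>\<Lambda>. x (\<psi> i))"

definition finite_fibre :: "'a set \<Rightarrow> ('a \<Rightarrow> 'a) \<Rightarrow> bool" where
  "finite_fibre A k \<longleftrightarrow> (\<forall>a\<in>A. finite (k -` {a} \<inter> A))"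

text \<open>
  Entropy of an onto finite fibre self-map \<open>g\<close> of \<open>A\<close>. The limit is taken in the extended reals:
  the backward images of a finite set may grow exponentially (e.g. for the one-sided full shift),
  in which case the limit is \<open>\<infinity>\<close>.
\<close>

definition ent_cset_at :: "'a set \<Rightarrow> ('a \<Rightarrow> 'a) \<Rightarrow> 'a set \<Rightarrow> ereal" where
  "ent_cset_at A g D = lim (\<lambda>n. ereal (real (card (\<Union>i<n. (g ^^ i) -` D \<inter> A)) / real n))"

definition ent_cset_onto :: "'a set \<Rightarrow> ('a \<Rightarrow> 'a) \<Rightarrow> ereal" where
  "ent_cset_onto A g = (SUP D \<in> {D. D \<subseteq> A \<and> finite D}. ent_cset_at A g D)"

definition surj_cover :: "'a set \<Rightarrow> ('a \<Rightarrow> 'a) \<Rightarrow> 'a set" where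
  "surj_cover A k = (\<Inter>n\<in>{1..}. (k ^^ n) ` A)"

text \<open>Only meaningful for a finite fibre self-map \<open>k\<close> of \<open>A\<close>.\<close>

definition ent_cset :: "'a set \<Rightarrow> ('a \<Rightarrow> 'a) \<Rightarrow> ereal" where
  "ent_cset A k = ent_cset_onto (surj_cover A k) k"

definition shift_rel :: "'i set \<Rightarrow> ('i \<Rightarrow> 'i) \<Rightarrow> ('i \<times> 'i) set" where
  "shift_rel \<Gamma> \<phi> = {(\<alpha>, \<beta>) \<in> \<Gamma> \<times> \<Gamma>. \<exists>n\<ge>1. (\<phi> ^^ n) \<alpha> = (\<phi> ^^ n) \<beta>}"

text \<open>
  The union runs over the representatives of a class and is the single class
  \<open>[\<phi>(\<alpha>)]\<close>; see \<open>quot_map_class\<close> below.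
\<close>

definition quot_map :: "'i set \<Rightarrow> ('i \<Rightarrow> 'i) \<Rightarrow> 'i set \<Rightarrow> 'i set" where
  "quot_map \<Gamma> \<phi> C = (\<Union>\<alpha>\<in>C. shift_rel \<Gamma> \<phi> `` {\<phi> \<alpha>})"

lemma funpow_eq_mono:
  fixes f :: "'a \<Rightarrow> 'a"
  assumes "(f ^^ n) x = (f ^^ n) y" and "n \<le> m"
  shows "(f ^^ m) x = (f ^^ m) y"
proof -
  obtain d where "m = d + n" using assms(2) by (metis add.commute le_Suc_ex)
  then show ?thesis using assms(1) by (simp add: funpow_add)
qed

lemma equiv_shift_rel: "equiv \<Gamma> (shift_rel \<Gamma> \<phi>)"
proof (rule equivI)
  show "shift_rel \<Gamma> \<phi> \<subseteq> \<Gamma> \<times> \<Gamma>" by (auto simp: shift_rel_def)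
  show "refl_on \<Gamma> (shift_rel \<Gamma> \<phi>)" by (auto simp: refl_on_def shift_rel_def)
  show "sym (shift_rel \<Gamma> \<phi>)" unfolding sym_def shift_rel_def by force
  show "trans (shift_rel \<Gamma> \<phi>)"
  proof (rule transI)
    fix x y z
    assume xy: "(x, y) \<in> shift_rel \<Gamma> \<phi>" and yz: "(y, z) \<in> shift_rel \<Gamma> \<phi>"
    from xy obtain n where n: "n \<ge> 1" "(\<phi> ^^ n) x = (\<phi> ^^ n) y" by (auto simp: shift_rel_def)
    from yz obtain m where m: "(\<phi> ^^ m) y = (\<phi> ^^ m) z" by (auto simp: shift_rel_def)
    have "(\<phi> ^^ max n m) x = (\<phi> ^^ max n m) z"
      using funpow_eq_mono[OF n(2), of "max n m"] funpow_eq_mono[OF m, of "max n m"] by simp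
    moreover have "max n m \<ge> 1" using n(1) by simp
    ultimately show "(x, z) \<in> shift_rel \<Gamma> \<phi>"
      using xy yz unfolding shift_rel_def by blast
  qed
qed

lemma quot_map_class:
  assumes "\<phi> \<in> \<Gamma> \<rightarrow> \<Gamma>" and "\<alpha> \<in> \<Gamma>"
  shows "quot_map \<Gamma> \<phi> (shift_rel \<Gamma> \<phi> `` {\<alpha>}) = shift_rel \<Gamma> \<phi> `` {\<phi> \<alpha>}"
proof -
  have "(\<phi> y, \<phi> z) \<in> shift_rel \<Gamma> \<phi>" if yz: "(y, z) \<in> shift_rel \<Gamma> \<phi>" for y z
  proof -
    obtain n where n: "n \<ge> 1" "(\<phi> ^^ n) y = (\<phi> ^^ n) z" using yz by (auto simp: shift_rel_def)
    have "(\<phi> ^^ n) (\<phi> y) = (\<phi> ^^ n) (\<phi> z)"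
      using n(2) by (metis funpow_swap1)
    then show ?thesis using n(1) yz assms(1) by (auto simp: shift_rel_def)
  qed
  then have "(\<lambda>\<alpha>. shift_rel \<Gamma> \<phi> `` {\<phi> \<alpha>}) respects shift_rel \<Gamma> \<phi>"
    by (auto intro!: congruentI equiv_class_eq[OF equiv_shift_rel])
  then show ?thesis
    unfolding quot_map_def using UN_equiv_class[OF equiv_shift_rel _ assms(2)] by blast
qed

text \<open>The entropy of the quotient shift is well defined whenever that of the original shift is.\<close>

lemma finite_fibre_quot_shift:
  fixes X :: "'x set"
  assumes phi: "\<phi> \<in> \<Gamma> \<rightarrow> \<Gamma>"
    and fin: "finite_fibre (\<Gamma> \<rightarrow>\<^sub>E X) (gen_shift \<Gamma> \<phi>)"
  shows "finite_fibre ((\<Gamma> // shift_rel \<Gamma> \<phi>) \<rightarrow>\<^sub>E X)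
           (gen_shift (\<Gamma> // shift_rel \<Gamma> \<phi>) (quot_map \<Gamma> \<phi>))"
  unfolding finite_fibre_def
proof
  let ?Q = "\<Gamma> // shift_rel \<Gamma> \<phi>"
  let ?c = "\<lambda>\<alpha>. shift_rel \<Gamma> \<phi> `` {\<alpha>}"
  define L where "L = (\<lambda>y :: 'a set \<Rightarrow> 'x. \<lambda>\<alpha>\<in>\<Gamma>. y (?c \<alpha>))"
  have cQ: "?c \<alpha> \<in> ?Q" if "\<alpha> \<in> \<Gamma>" for \<alpha> using that by (rule quotientI)
  have L_in: "L y \<in> \<Gamma> \<rightarrow>\<^sub>E X" if "y \<in> ?Q \<rightarrow>\<^sub>E X" for y
    unfolding L_def using that cQ by (auto dest!: PiE_mem)
  have inj: "inj_on L (?Q \<rightarrow>\<^sub>E X)"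
  proof (rule inj_onI)
    fix y z assume y: "y \<in> ?Q \<rightarrow>\<^sub>E X" and z: "z \<in> ?Q \<rightarrow>\<^sub>E X" and eq: "L y = L z"
    show "y = z"
    proof (rule PiE_ext[OF y z])
      fix C assume "C \<in> ?Q"
      then obtain \<alpha> where "\<alpha> \<in> \<Gamma>" "C = ?c \<alpha>" by (rule quotientE)
      then show "y C = z C" using fun_cong[OF eq, of \<alpha>] by (simp add: L_def)
    qed
  qed
  have comm: "L (gen_shift ?Q (quot_map \<Gamma> \<phi>) y) = gen_shift \<Gamma> \<phi> (L y)" for y
    using phi cQ by (auto simp: L_def gen_shift_def quot_map_class fun_eq_iff)
  fix a assume a: "a \<in> ?Q \<rightarrow>\<^sub>E X"
  let ?F = "gen_shift ?Q (quot_map \<Gamma> \<phi>) -` {a} \<inter> (?Q \<rightarrow>\<^sub>E X)"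
  have "L ` ?F \<subseteq> gen_shift \<Gamma> \<phi> -` {L a} \<inter> (\<Gamma> \<rightarrow>\<^sub>E X)"
    using L_in comm by (auto simp flip: comm)
  moreover have "finite (gen_shift \<Gamma> \<phi> -` {L a} \<inter> (\<Gamma> \<rightarrow>\<^sub>E X))"
    using fin L_in[OF a] unfolding finite_fibre_def by blast
  ultimately have "finite (L ` ?F)" by (rule finite_subset)
  moreover have "inj_on L ?F" using inj by (rule inj_on_subset) blast
  ultimately show "finite ?F" by (rule finite_imageD)
qed

end

theory Submission
  imports Defs "HOL-Real_Asymp.Real_Asymp"
begin

text \<open>
  Write \<open>\<psi>\<close> for the induced map on the quotient. It is injective, because the relation identifies
  any two points that \<open>\<phi>\<close> sends to related points. For an injective map the generalized shift is
  onto, so that its surjective cover is the whole space. Pulling back along the quotient map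
  (\<open>class_pullback\<close>) embeds \<open>X\<^sup>Q\<close>, where \<open>Q\<close> is the quotient, into \<open>X\<^sup>\<Gamma>\<close> as the set of the points
  that are constant on classes. This set is exactly the surjective cover of the shift of \<open>\<phi>\<close>: two
  points identified by \<open>\<phi>\<^sup>n\<close> carry the same coordinate in every element of the image of the
  \<open>n\<close>-th iterate, and conversely
  the onto shift on \<open>X\<^sup>Q\<close>, which commutes with the pullback, provides preimages of
  all orders (\<open>surj_cover_gen_shift\<close>). So the two entropies agree, and it remains to compute the
  entropy of the shift \<open>\<sigma>\<close> of an injective map \<open>\<psi>\<close> (\<open>ent_gen_shift_inj\<close>).

  If \<open>\<psi>\<^sup>n = id\<close>, then \<open>\<sigma>\<^sup>n = id\<close>, all backward images of a finite set lie in one finite set and the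
  entropy is \<open>0\<close>. If \<open>\<psi>\<close> is not onto, a coordinate outside its range may be changed freely, so all
  fibres have at least two points and the backward images of a single point
  at least double in size at each
  step. If \<open>\<psi>\<close> is a permutation of infinite order, then so is \<open>\<sigma>\<close>, and it suffices to find infinitely
  many points with infinite and pairwise disjoint \<open>\<sigma>\<close>-orbits: \<open>j\<close> of them have exactly \<open>j * n\<close>
  backward images up to time \<open>n\<close>. Such points are indicator functions of subsets of the index set:
  of the initial segments of an infinite \<open>\<psi>\<close>-orbit if there is one, and otherwise of the
  sets of one chosen point for each period \<open>\<ge> p\<close>, where \<open>p\<close> ranges over the infinitely many periods of \<open>\<psi>\<close>.
\<close>

section \<open>Entropy of onto maps\<close>

lemma funpow_closed:
  assumes "f \<in> A \<rightarrow> A" and "x \<in> A"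
  shows "(f ^^ n) x \<in> A"
  using assms by (induction n) auto

lemma funpow_image:
  assumes "f ` A = A"
  shows "(f ^^ n) ` A = A"
proof (induction n)
  case (Suc n)
  have "(f ^^ Suc n) ` A = f ` ((f ^^ n) ` A)" by (simp add: image_image)
  then show ?case using Suc assms by simp
qed simp

lemma ent_cset_onto_conjugate:
  assumes L: "bij_betw L A B" and g: "g \<in> A \<rightarrow> A"
    and comm: "\<And>x. x \<in> A \<Longrightarrow> L (g x) = h (L x)"
  shows "ent_cset_onto A g = ent_cset_onto B h"
proof -
  have pow: "(h ^^ i) (L x) = L ((g ^^ i) x)" if "x \<in> A" for i x
    using that funpow_closed[OF g that] comm by (induction i) auto
  have inj: "inj_on L A" and im: "L ` A = B" using L by (auto simp: bij_betw_def)
  have pre: "(h ^^ i) -` (L ` D) \<inter> B = L ` ((g ^^ i) -` D \<inter> A)" if "D \<subseteq> A" for D i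
  proof -
    have "L ((g ^^ i) x) \<in> L ` D \<longleftrightarrow> (g ^^ i) x \<in> D" if "x \<in> A" for x
      using inj_on_image_mem_iff[OF inj funpow_closed[OF g that] \<open>D \<subseteq> A\<close>] .
    then have "{x \<in> A. (h ^^ i) (L x) \<in> L ` D} = {x \<in> A. (g ^^ i) x \<in> D}"
      by (metis (no_types, lifting) pow)
    then have "L ` {x \<in> A. (h ^^ i) (L x) \<in> L ` D} = L ` ((g ^^ i) -` D \<inter> A)"
      by (simp add: vimage_def Int_def conj_commute)
    moreover have "(h ^^ i) -` (L ` D) \<inter> B = L ` {x \<in> A. (h ^^ i) (L x) \<in> L ` D}"
      unfolding im[symmetric] by auto
    ultimately show ?thesis by simp
  qed
  have "ent_cset_at B h (L ` D) = ent_cset_at A g D" if "D \<subseteq> A" for D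
  proof -
    have "card (\<Union>i<n. (h ^^ i) -` (L ` D) \<inter> B) = card (\<Union>i<n. (g ^^ i) -` D \<inter> A)" for n
    proof -
      have "(\<Union>i<n. (h ^^ i) -` (L ` D) \<inter> B) = L ` (\<Union>i<n. (g ^^ i) -` D \<inter> A)"
        by (simp only: pre[OF that] image_UN)
      moreover have "inj_on L (\<Union>i<n. (g ^^ i) -` D \<inter> A)"
        using inj by (rule inj_on_subset) blast
      ultimately show ?thesis by (simp only: card_image)
    qed
    then show ?thesis by (simp add: ent_cset_at_def)
  qed
  moreover have "{D. D \<subseteq> B \<and> finite D} = (\<lambda>D. L ` D) ` {D. D \<subseteq> A \<and> finite D}"
  proof (intro equalityI subsetI)
    fix E assume "E \<in> {D. D \<subseteq> B \<and> finite D}"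
    then obtain D where "D \<subseteq> A" "finite D" "E = L ` D"
      unfolding im[symmetric] using finite_subset_image[of E L A] by blast
    then show "E \<in> (\<lambda>D. L ` D) ` {D. D \<subseteq> A \<and> finite D}" by simp
  qed (use im in auto)
  ultimately show ?thesis
    unfolding ent_cset_onto_def by (simp add: image_image)
qed

lemma ent_cset_onto_eq_PInfty:
  assumes "\<And>j::nat. \<exists>D\<subseteq>A. finite D \<and> ereal (real j) \<le> ent_cset_at A g D"
  shows "ent_cset_onto A g = \<infinity>"
proof (rule ereal_top)
  fix c :: real
  obtain j :: nat where "c \<le> real j" using real_arch_simple by blast
  moreover obtain D where "D \<subseteq> A" "finite D" "ereal (real j) \<le> ent_cset_at A g D"
    using assms by blast
  moreover from this have "ent_cset_at A g D \<le> ent_cset_onto A g"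
    unfolding ent_cset_onto_def by (intro SUP_upper) simp
  ultimately show "ereal c \<le> ent_cset_onto A g"
    by (meson ereal_less_eq(3) order_trans)
qed

text \<open>
  If \<open>g\<^sup>N = id\<close>, every backward image of \<open>D\<close> lies in a forward image of \<open>D\<close>, and each forward image
  equals one of the first \<open>N\<close>. So the cardinalities in the limit stay bounded.
\<close>

lemma ent_cset_onto_periodic:
  assumes N: "N \<ge> 1" and per: "\<And>x. x \<in> A \<Longrightarrow> (g ^^ N) x = x"
  shows "ent_cset_onto A g = 0"
proof -
  have md: "(g ^^ m) x = (g ^^ (m mod N)) x" if "x \<in> A" for m x
    using funpow_mod_eq[OF per[OF that]] by simp
  have mult: "(g ^^ (k * N)) x = x" if "x \<in> A" for k x
    using md[OF that, of "k * N"] by simp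
  have "ent_cset_at A g D = 0" if D: "D \<subseteq> A" "finite D" for D
  proof -
    define F where "F = (\<Union>k<N. (g ^^ k) ` D)"
    have "finite F" using D by (auto simp: F_def)
    have sub: "(g ^^ i) -` D \<inter> A \<subseteq> F" for i
    proof
      fix x assume x: "x \<in> (g ^^ i) -` D \<inter> A"
      \<comment> \<open>On \<open>A\<close>, the iterate of order \<open>i * N - i\<close> undoes the iterate of order \<open>i\<close>.\<close>
      have "x = (g ^^ (i * N - i + i)) x" using mult[of x i] x N by simp
      also have "\<dots> = (g ^^ (i * N - i)) ((g ^^ i) x)" by (simp only: funpow_add o_def)
      also have "\<dots> = (g ^^ ((i * N - i) mod N)) ((g ^^ i) x)" using x D by (intro md) auto
      finally have "x = (g ^^ ((i * N - i) mod N)) ((g ^^ i) x)" .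
      moreover have "(i * N - i) mod N < N" using N by simp
      ultimately show "x \<in> F" using x unfolding F_def by blast
    qed
    have card_le: "card (\<Union>i<n. (g ^^ i) -` D \<inter> A) \<le> card F" for n
      by (rule card_mono[OF \<open>finite F\<close>]) (use sub in blast)
    have "(\<lambda>n. real (card (\<Union>i<n. (g ^^ i) -` D \<inter> A)) / real n) \<longlonglongrightarrow> 0"
    proof (rule tendsto_sandwich[where f = "\<lambda>_. 0" and h = "\<lambda>n. real (card F) / real n"])
      show "(\<lambda>n. real (card F) / real n) \<longlonglongrightarrow> 0" by (rule lim_const_over_n)
      show "\<forall>\<^sub>F n in sequentially. real (card (\<Union>i<n. (g ^^ i) -` D \<inter> A)) / real n \<le> real (card F) / real n"
        using card_le by (intro always_eventually allI divide_right_mono) (simp_all only: of_nat_le_iff of_nat_0_le_iff)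
      show "\<forall>\<^sub>F n in sequentially. 0 \<le> real (card (\<Union>i<n. (g ^^ i) -` D \<inter> A)) / real n"
        by (intro always_eventually allI) simp
    qed (rule tendsto_const)
    then have "(\<lambda>n. ereal (real (card (\<Union>i<n. (g ^^ i) -` D \<inter> A)) / real n)) \<longlonglongrightarrow> 0"
      by (simp add: zero_ereal_def)
    then show ?thesis unfolding ent_cset_at_def by (rule limI)
  qed
  then have "ent_cset_onto A g = (SUP D \<in> {D. D \<subseteq> A \<and> finite D}. 0)"
    unfolding ent_cset_onto_def by (intro SUP_cong) auto
  also have "\<dots> = 0" by (rule SUP_const) blast
  finally show ?thesis .
qed

text \<open>
  The condition on \<open>W\<close> says that its points have infinite and pairwise disjoint orbits: a relation
  \<open>g\<^sup>m u = v\<close> with \<open>m = 0\<close> also forces \<open>u = v\<close>. The backward images of a finite subset of \<open>W\<close> are then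
  pairwise disjoint, and they all have the same size since \<open>g\<close> is a bijection.
\<close>

lemma ent_cset_onto_free_orbits:
  assumes g: "bij_betw g A A" and W: "infinite W" "W \<subseteq> A"
    and free: "\<And>u v m. u \<in> W \<Longrightarrow> v \<in> W \<Longrightarrow> (g ^^ m) u = v \<Longrightarrow> m = 0"
  shows "ent_cset_onto A g = \<infinity>"
proof (rule ent_cset_onto_eq_PInfty)
  fix j :: nat
  obtain D where D: "finite D" "card D = j" "D \<subseteq> W"
    using infinite_arbitrarily_large[OF W(1)] by blast
  define E where "E = (\<lambda>i. (g ^^ i) -` D \<inter> A)"
  have bij: "bij_betw (g ^^ i) A A" for i by (rule bij_betw_funpow[OF g])
  have E: "bij_betw (g ^^ i) (E i) D" for i
    unfolding bij_betw_def
  proof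
    show "inj_on (g ^^ i) (E i)"
      using bij[of i] by (auto simp: E_def bij_betw_def intro: inj_on_subset)
    have "D \<subseteq> (g ^^ i) ` A" using bij[of i] D W by (auto simp: bij_betw_def)
    then show "(g ^^ i) ` E i = D" by (auto simp: E_def)
  qed
  have lt: "E i \<inter> E k = {}" if "i < k" for i k
  proof (rule ccontr)
    assume "E i \<inter> E k \<noteq> {}"
    then obtain x where x: "(g ^^ i) x \<in> D" "(g ^^ k) x \<in> D" by (auto simp: E_def)
    have "(g ^^ (k - i)) ((g ^^ i) x) = (g ^^ (k - i + i)) x" by (simp only: funpow_add o_def)
    then have "(g ^^ (k - i)) ((g ^^ i) x) = (g ^^ k) x" using that by simp
    then have "k - i = 0" using x D by (intro free) auto
    then show False using that by simp
  qed
  have disj: "E i \<inter> E k = {}" if "i \<noteq> k" for i k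
    using that lt[of i k] lt[of k i] by (metis inf_commute nat_neq_iff)
  have "card (\<Union>i<n. E i) = n * j" for n
  proof -
    have "finite (E i)" for i using bij_betw_finite[OF E[of i]] D by simp
    then have "card (\<Union>i<n. E i) = (\<Sum>i<n. card (E i))"
      using disj by (intro card_UN_disjoint) auto
    also have "\<dots> = n * j" using bij_betw_same_card[OF E] D by simp
    finally show ?thesis .
  qed
  then have "eventually (\<lambda>n. ereal (real j) = ereal (real (card (\<Union>i<n. E i)) / real n)) sequentially"
    by (intro eventually_sequentiallyI[of 1]) auto
  then have "(\<lambda>n. ereal (real (card (\<Union>i<n. E i)) / real n)) \<longlonglongrightarrow> ereal (real j)"
    by (rule Lim_transform_eventually[OF tendsto_const])
  then have "ent_cset_at A g D = ereal (real j)"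
    unfolding ent_cset_at_def E_def by (rule limI)
  then show "\<exists>D\<subseteq>A. finite D \<and> ereal (real j) \<le> ent_cset_at A g D"
    using D W by (intro exI[of _ D]) auto
qed

text \<open>
  The backward image of order \<open>n + 1\<close> is the disjoint union of the fibres over that of order \<open>n\<close>.
  Finiteness is part of the induction because infinite sets have cardinality \<open>0\<close> by convention.
\<close>

lemma card_backward_images_ge:
  assumes g: "g \<in> A \<rightarrow> A" and fin: "finite_fibre A g"
    and two: "\<And>y. y \<in> A \<Longrightarrow> 2 \<le> card (g -` {y} \<inter> A)" and x: "x \<in> A"
  shows "finite ((g ^^ n) -` {x} \<inter> A) \<and> 2 ^ n \<le> card ((g ^^ n) -` {x} \<inter> A)"
proof (induction n)
  case 0
  have "(g ^^ 0) -` {x} \<inter> A = {x}" using x by auto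
  then show ?case by simp
next
  case (Suc n)
  let ?P = "(g ^^ n) -` {x} \<inter> A"
  have eq: "(g ^^ Suc n) -` {x} \<inter> A = (\<Union>y\<in>?P. g -` {y} \<inter> A)"
    using g by (auto simp: funpow_Suc_right simp del: funpow.simps)
  have ff: "finite (g -` {y} \<inter> A)" if "y \<in> A" for y
    using fin that by (simp add: finite_fibre_def)
  have "card (\<Union>y\<in>?P. g -` {y} \<inter> A) = (\<Sum>y\<in>?P. card (g -` {y} \<inter> A))"
    using Suc ff by (intro card_UN_disjoint) auto
  moreover have "card ?P * 2 \<le> (\<Sum>y\<in>?P. card (g -` {y} \<inter> A))"
    using sum_bounded_below[of ?P 2 "\<lambda>y. card (g -` {y} \<inter> A)"] two by auto
  ultimately have "2 ^ Suc n \<le> card (\<Union>y\<in>?P. g -` {y} \<inter> A)"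
    using Suc unfolding power_Suc by linarith
  moreover have "finite (\<Union>y\<in>?P. g -` {y} \<inter> A)" using Suc ff by (intro finite_UN_I) auto
  ultimately show ?case by (simp only: eq)
qed

lemma ent_cset_onto_branching:
  assumes g: "g \<in> A \<rightarrow> A" and fin: "finite_fibre A g" and "A \<noteq> {}"
    and two: "\<And>y. y \<in> A \<Longrightarrow> 2 \<le> card (g -` {y} \<inter> A)"
  shows "ent_cset_onto A g = \<infinity>"
proof (rule ent_cset_onto_eq_PInfty)
  fix j :: nat
  obtain x where x: "x \<in> A" using \<open>A \<noteq> {}\<close> by blast
  let ?a = "\<lambda>n. card (\<Union>i<n. (g ^^ i) -` {x} \<inter> A)"
  note growth = card_backward_images_ge[OF g fin two x]
  have "2 ^ n \<le> ?a (Suc n)" for n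
  proof -
    have "2 ^ n \<le> card ((g ^^ n) -` {x} \<inter> A)" using growth by blast
    also have "\<dots> \<le> ?a (Suc n)" using growth by (intro card_mono finite_UN_I) auto
    finally show ?thesis .
  qed
  then have pow: "2 ^ n / real (Suc n) \<le> real (?a (Suc n)) / real (Suc n)" for n
    by (intro divide_right_mono) (metis of_nat_le_iff of_nat_numeral of_nat_power, simp)
  have "filterlim (\<lambda>n. 2 ^ n / real (Suc n)) at_top sequentially" by real_asymp
  then have "filterlim (\<lambda>n. real (?a (Suc n)) / real (Suc n)) at_top sequentially"
    by (rule filterlim_at_top_mono) (use pow in simp)
  then have "(\<lambda>n. ereal (real (?a (Suc n)) / real (Suc n))) \<longlonglongrightarrow> \<infinity>"
    by (simp add: tendsto_PInfty_eq_at_top)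
  then have "(\<lambda>n. ereal (real (?a n) / real n)) \<longlonglongrightarrow> \<infinity>"
    by (rule filterlim_sequentially_Suc[THEN iffD1])
  then have "ent_cset_at A g {x} = \<infinity>" unfolding ent_cset_at_def by (rule limI)
  then show "\<exists>D\<subseteq>A. finite D \<and> ereal (real j) \<le> ent_cset_at A g D"
    using x by (intro exI[of _ "{x}"]) auto
qed

section \<open>Generalized shifts of injective maps\<close>

lemma gen_shift_closed:
  assumes "\<psi> \<in> \<Lambda> \<rightarrow> \<Lambda>"
  shows "gen_shift \<Lambda> \<psi> \<in> (\<Lambda> \<rightarrow>\<^sub>E X) \<rightarrow> (\<Lambda> \<rightarrow>\<^sub>E X)"
  using assms by (auto simp: gen_shift_def PiE_iff)

lemma gen_shift_funpow:
  assumes psi: "\<psi> \<in> \<Lambda> \<rightarrow> \<Lambda>" and x: "x \<in> \<Lambda> \<rightarrow>\<^sub>E X"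
  shows "(gen_shift \<Lambda> \<psi> ^^ n) x = (\<lambda>i\<in>\<Lambda>. x ((\<psi> ^^ n) i))"
proof (induction n)
  case 0
  show ?case using x by (auto simp: PiE_iff extensional_restrict)
next
  case (Suc n)
  have "(gen_shift \<Lambda> \<psi> ^^ Suc n) x = gen_shift \<Lambda> \<psi> (\<lambda>i\<in>\<Lambda>. x ((\<psi> ^^ n) i))"
    by (simp only: funpow.simps o_def Suc)
  also have "\<dots> = (\<lambda>i\<in>\<Lambda>. x ((\<psi> ^^ Suc n) i))"
    using psi by (auto simp: gen_shift_def fun_eq_iff funpow_Suc_right simp del: funpow.simps)
  finally show ?case .
qed

text \<open>
  An element \<open>y\<close> prescribes a preimage \<open>x\<close> on the range of \<open>\<psi>\<close> and nowhere else, by \<open>x (\<psi> i) = y i\<close>.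
\<close>

lemma gen_shift_preimage:
  assumes psi: "\<psi> \<in> \<Lambda> \<rightarrow> \<Lambda>" and inj: "inj_on \<psi> \<Lambda>" and c: "c \<in> X" and y: "y \<in> \<Lambda> \<rightarrow>\<^sub>E X"
  shows "\<exists>x \<in> \<Lambda> \<rightarrow>\<^sub>E X. gen_shift \<Lambda> \<psi> x = y \<and> (\<forall>i \<in> \<Lambda> - \<psi> ` \<Lambda>. x i = c)"
proof -
  define x where "x = (\<lambda>i\<in>\<Lambda>. if i \<in> \<psi> ` \<Lambda> then y (inv_into \<Lambda> \<psi> i) else c)"
  have "x \<in> \<Lambda> \<rightarrow>\<^sub>E X"
    using y c by (auto simp: x_def PiE_iff inv_into_f_f[OF inj])
  moreover have "gen_shift \<Lambda> \<psi> x = y"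
  proof
    fix i show "gen_shift \<Lambda> \<psi> x i = y i"
      using psi y by (cases "i \<in> \<Lambda>") (auto simp: x_def gen_shift_def inv_into_f_f[OF inj] PiE_iff extensional_def)
  qed
  moreover have "\<forall>i \<in> \<Lambda> - \<psi> ` \<Lambda>. x i = c" by (simp add: x_def)
  ultimately show ?thesis by blast
qed

lemma gen_shift_onto:
  assumes psi: "\<psi> \<in> \<Lambda> \<rightarrow> \<Lambda>" and inj: "inj_on \<psi> \<Lambda>" and "X \<noteq> {}"
  shows "gen_shift \<Lambda> \<psi> ` (\<Lambda> \<rightarrow>\<^sub>E X) = \<Lambda> \<rightarrow>\<^sub>E X"
proof -
  obtain c where "c \<in> X" using \<open>X \<noteq> {}\<close> by blast
  have "\<Lambda> \<rightarrow>\<^sub>E X \<subseteq> gen_shift \<Lambda> \<psi> ` (\<Lambda> \<rightarrow>\<^sub>E X)"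
  proof
    fix y assume "y \<in> \<Lambda> \<rightarrow>\<^sub>E X"
    then obtain x where "x \<in> \<Lambda> \<rightarrow>\<^sub>E X" "gen_shift \<Lambda> \<psi> x = y"
      using gen_shift_preimage[OF psi inj \<open>c \<in> X\<close>] by blast
    then show "y \<in> gen_shift \<Lambda> \<psi> ` (\<Lambda> \<rightarrow>\<^sub>E X)" by (intro image_eqI[of y]) simp_all
  qed
  moreover have "gen_shift \<Lambda> \<psi> ` (\<Lambda> \<rightarrow>\<^sub>E X) \<subseteq> \<Lambda> \<rightarrow>\<^sub>E X"
    using gen_shift_closed[OF psi] by (rule funcset_image)
  ultimately show ?thesis by (rule equalityI[rotated])
qed

text \<open>
  A coordinate outside the range of \<open>\<psi>\<close> is forgotten by the shift, so both values \<open>a\<close> and \<open>b\<close> occur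
  there in every fibre.
\<close>

lemma ent_gen_shift_not_onto:
  assumes psi: "\<psi> \<in> \<Lambda> \<rightarrow> \<Lambda>" and inj: "inj_on \<psi> \<Lambda>" and ne: "\<psi> ` \<Lambda> \<noteq> \<Lambda>"
    and ab: "a \<in> X" "b \<in> X" "a \<noteq> b"
    and fin: "finite_fibre (\<Lambda> \<rightarrow>\<^sub>E X) (gen_shift \<Lambda> \<psi>)"
  shows "ent_cset_onto (\<Lambda> \<rightarrow>\<^sub>E X) (gen_shift \<Lambda> \<psi>) = \<infinity>"
proof (rule ent_cset_onto_branching[OF gen_shift_closed[OF psi] fin])
  show "\<Lambda> \<rightarrow>\<^sub>E X \<noteq> {}" using ab by (auto simp: PiE_eq_empty_iff)
  obtain i where i: "i \<in> \<Lambda> - \<psi> ` \<Lambda>" using psi ne by blast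
  fix y assume y: "y \<in> \<Lambda> \<rightarrow>\<^sub>E X"
  let ?F = "gen_shift \<Lambda> \<psi> -` {y} \<inter> (\<Lambda> \<rightarrow>\<^sub>E X)"
  obtain u v where "u \<in> ?F" "u i = a" "v \<in> ?F" "v i = b"
    using gen_shift_preimage[OF psi inj ab(1) y] gen_shift_preimage[OF psi inj ab(2) y] i by blast
  then have "{u, v} \<subseteq> ?F" "u \<noteq> v" using ab(3) by blast+
  then have "{u, v} \<subseteq> ?F" "card {u, v} = 2" by simp_all
  moreover have "finite ?F" using fin y by (simp add: finite_fibre_def)
  ultimately show "2 \<le> card ?F" by (metis card_mono)
qed

text \<open>
  Indicator functions turn the shift into the preimage operation on subsets of the index set, so
  free orbits of the shift can be looked for among sets.
\<close>

lemma ent_gen_shift_free_sets: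
  assumes bij: "bij_betw \<psi> \<Lambda> \<Lambda>" and ab: "a \<in> X" "b \<in> X" "a \<noteq> b"
    and S: "infinite \<S>" "\<And>S. S \<in> \<S> \<Longrightarrow> S \<subseteq> \<Lambda>"
    and free: "\<And>S T m. S \<in> \<S> \<Longrightarrow> T \<in> \<S> \<Longrightarrow> (\<And>i. i \<in> \<Lambda> \<Longrightarrow> (\<psi> ^^ m) i \<in> S \<longleftrightarrow> i \<in> T) \<Longrightarrow> m = 0"
  shows "ent_cset_onto (\<Lambda> \<rightarrow>\<^sub>E X) (gen_shift \<Lambda> \<psi>) = \<infinity>"
proof -
  define ind where "ind = (\<lambda>S. \<lambda>i\<in>\<Lambda>. if i \<in> S then b else a)"
  have psi: "\<psi> \<in> \<Lambda> \<rightarrow> \<Lambda>" and inj: "inj_on \<psi> \<Lambda>" and onto: "\<psi> ` \<Lambda> = \<Lambda>"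
    using bij by (auto simp: bij_betw_def)
  have ind_in: "ind S \<in> \<Lambda> \<rightarrow>\<^sub>E X" for S using ab by (auto simp: ind_def)
  have ind_eq: "i \<in> S \<longleftrightarrow> ind S i = b" if "i \<in> \<Lambda>" for S i using ab that by (simp add: ind_def)
  have "inj_on (gen_shift \<Lambda> \<psi>) (\<Lambda> \<rightarrow>\<^sub>E X)"
  proof (rule inj_onI)
    fix x y assume x: "x \<in> \<Lambda> \<rightarrow>\<^sub>E X" and y: "y \<in> \<Lambda> \<rightarrow>\<^sub>E X"
      and eq: "gen_shift \<Lambda> \<psi> x = gen_shift \<Lambda> \<psi> y"
    show "x = y"
    proof (rule PiE_ext[OF x y])
      fix i assume "i \<in> \<Lambda>"
      then obtain k where "k \<in> \<Lambda>" "i = \<psi> k" using onto by blast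
      then show "x i = y i" using fun_cong[OF eq, of k] by (simp add: gen_shift_def)
    qed
  qed
  then have "bij_betw (gen_shift \<Lambda> \<psi>) (\<Lambda> \<rightarrow>\<^sub>E X) (\<Lambda> \<rightarrow>\<^sub>E X)"
    unfolding bij_betw_def using gen_shift_onto[OF psi inj, of X] ab(1) by blast
  moreover have "infinite (ind ` \<S>)"
  proof -
    have "inj_on ind \<S>"
    proof (rule inj_onI)
      fix S T assume ST: "S \<in> \<S>" "T \<in> \<S>" "ind S = ind T"
      have "i \<in> S \<longleftrightarrow> i \<in> T" if "i \<in> \<Lambda>" for i using ind_eq[OF that] ST(3) by simp
      then show "S = T" using S(2)[OF ST(1)] S(2)[OF ST(2)] by blast
    qed
    then show ?thesis using S(1) finite_imageD by blast
  qed
  moreover have "ind ` \<S> \<subseteq> \<Lambda> \<rightarrow>\<^sub>E X" using ind_in by blast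
  ultimately show ?thesis
  proof (rule ent_cset_onto_free_orbits)
    fix u v m assume "u \<in> ind ` \<S>" "v \<in> ind ` \<S>" and uv: "(gen_shift \<Lambda> \<psi> ^^ m) u = v"
    then obtain S T where ST: "S \<in> \<S>" "T \<in> \<S>" "u = ind S" "v = ind T" by blast
    have "(\<psi> ^^ m) i \<in> S \<longleftrightarrow> i \<in> T" if i: "i \<in> \<Lambda>" for i
    proof -
      have "ind T i = ind S ((\<psi> ^^ m) i)"
        using i uv[symmetric] unfolding ST gen_shift_funpow[OF psi ind_in] by simp
      then show ?thesis using ind_eq[OF i] ind_eq[OF funpow_closed[OF psi i]] by simp
    qed
    then show "m = 0" using free ST by blast
  qed
qed

text \<open>
  The initial segments of an infinite orbit have infinite and pairwise disjoint orbits under the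
  preimage operation: the first point \<open>c\<close> of the orbit has a preimage under \<open>\<psi>\<^sup>m\<close>, which can only lie
  in a segment starting at \<open>c\<close> if \<open>m = 0\<close>.
\<close>

lemma ent_gen_shift_infinite_orbit:
  assumes bij: "bij_betw \<psi> \<Lambda> \<Lambda>" and ab: "a \<in> X" "b \<in> X" "a \<noteq> b"
    and c: "c \<in> \<Lambda>" "inj (\<lambda>n. (\<psi> ^^ n) c)"
  shows "ent_cset_onto (\<Lambda> \<rightarrow>\<^sub>E X) (gen_shift \<Lambda> \<psi>) = \<infinity>"
proof -
  define S where "S = (\<lambda>k::nat. (\<lambda>n. (\<psi> ^^ n) c) ` {..k})"
  have psi: "\<psi> \<in> \<Lambda> \<rightarrow> \<Lambda>" using bij by (auto simp: bij_betw_def)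
  have mem: "(\<psi> ^^ n) c \<in> S k \<longleftrightarrow> n \<le> k" for n k
    using injD[OF c(2)] by (auto simp: S_def)
  have "inj S"
    by (rule injI) (metis mem order_refl order_antisym)
  then have "infinite (range S)" using finite_imageD by blast
  moreover have "T \<subseteq> \<Lambda>" if "T \<in> range S" for T
    using that funpow_closed[OF psi c(1)] by (auto simp: S_def)
  ultimately show ?thesis
  proof (rule ent_gen_shift_free_sets[OF bij ab])
    fix T U m assume "T \<in> range S" "U \<in> range S"
      and eq: "\<And>i. i \<in> \<Lambda> \<Longrightarrow> (\<psi> ^^ m) i \<in> T \<longleftrightarrow> i \<in> U"
    then obtain k l where kl: "T = S k" "U = S l" by blast
    have "(\<psi> ^^ m) ` \<Lambda> = \<Lambda>" using bij_betw_funpow[OF bij, of m] by (simp add: bij_betw_def)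
    then have "c \<in> (\<psi> ^^ m) ` \<Lambda>" using c(1) by simp
    then obtain d where d: "d \<in> \<Lambda>" "(\<psi> ^^ m) d = c" by (rule imageE) simp
    have "c \<in> S k" using mem[of 0 k] by simp
    then have "d \<in> S l" using eq[OF d(1)] d(2) kl by simp
    then obtain n where "d = (\<psi> ^^ n) c" by (auto simp: S_def)
    then have "(\<psi> ^^ (m + n)) c = (\<psi> ^^ 0) c" using d(2) by (simp add: funpow_add)
    then have "m + n = 0" by (rule injD[OF c(2)])
    then show "m = 0" by simp
  qed
qed

text \<open>
  If all points are periodic and \<open>\<psi>\<close> has infinite order, then infinitely many periods occur. Since
  \<open>\<psi>\<close> preserves periods, once one point of each period is chosen, \<open>\<psi>\<^sup>m\<close> can send chosen points to
  chosen points only by fixing them. If it does so for all periods from some bound on, then \<open>m\<close> is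
  a multiple of arbitrarily large numbers, hence \<open>0\<close>.
\<close>

lemma ent_gen_shift_unbounded_periods:
  assumes bij: "bij_betw \<psi> \<Lambda> \<Lambda>" and ab: "a \<in> X" "b \<in> X" "a \<noteq> b"
    and per: "\<And>i. i \<in> \<Lambda> \<Longrightarrow> \<exists>n\<ge>1. (\<psi> ^^ n) i = i"
    and ord: "\<nexists>n. n \<ge> 1 \<and> (\<forall>i\<in>\<Lambda>. (\<psi> ^^ n) i = i)"
  shows "ent_cset_onto (\<Lambda> \<rightarrow>\<^sub>E X) (gen_shift \<Lambda> \<psi>) = \<infinity>"
proof -
  define p where "p = (\<lambda>i. LEAST n. n \<ge> 1 \<and> (\<psi> ^^ n) i = i)"
  have psi: "\<psi> \<in> \<Lambda> \<rightarrow> \<Lambda>" using bij by (auto simp: bij_betw_def)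
  have p: "p i \<ge> 1" "(\<psi> ^^ p i) i = i" if "i \<in> \<Lambda>" for i
    using LeastI_ex[OF per[OF that]] by (auto simp: p_def)
  have p_le: "p i \<le> n" if "n \<ge> 1" "(\<psi> ^^ n) i = i" for i n
    using that unfolding p_def by (intro Least_le) simp
  have p_inv: "p ((\<psi> ^^ m) i) = p i" if i: "i \<in> \<Lambda>" for m i
  proof -
    have inj: "inj_on (\<psi> ^^ m) \<Lambda>" using bij_betw_funpow[OF bij] by (simp add: bij_betw_def)
    have "(\<psi> ^^ n) ((\<psi> ^^ m) i) = (\<psi> ^^ m) i \<longleftrightarrow> (\<psi> ^^ n) i = i" for n
    proof -
      have "(\<psi> ^^ n) ((\<psi> ^^ m) i) = (\<psi> ^^ m) ((\<psi> ^^ n) i)"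
        by (metis add.commute comp_apply funpow_add)
      then show ?thesis using inj_on_eq_iff[OF inj funpow_closed[OF psi i] i] by simp
    qed
    then show ?thesis by (simp add: p_def)
  qed
  have inf: "infinite (p ` \<Lambda>)"
  proof
    assume fin: "finite (p ` \<Lambda>)"
    \<comment> \<open>A common multiple of all periods is an exponent of \<open>\<psi>\<close>.\<close>
    define N where "N = \<Prod>(p ` \<Lambda>)"
    have "N \<ge> 1"
      unfolding N_def using p(1) by (intro prod_ge_1) auto
    moreover have "(\<psi> ^^ N) i = i" if i: "i \<in> \<Lambda>" for i
    proof -
      have "p i dvd N" unfolding N_def using fin i by (intro dvd_prodI) auto
      then obtain k where k: "N = p i * k" by blast
      have "((\<psi> ^^ p i) ^^ k) i = i" using p(2)[OF i] by (induction k) auto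
      then show ?thesis by (simp add: k funpow_mult)
    qed
    ultimately show False using ord by blast
  qed
  define c where "c = inv_into \<Lambda> p"
  define S where "S = (\<lambda>r. c ` {t \<in> p ` \<Lambda>. r \<le> t})"
  have c: "c t \<in> \<Lambda>" "p (c t) = t" if "t \<in> p ` \<Lambda>" for t
    using inv_into_into[OF that] f_inv_into_f[OF that] by (auto simp: c_def)
  have mem: "c t \<in> S r \<longleftrightarrow> r \<le> t" if "t \<in> p ` \<Lambda>" for t r
  proof
    assume "c t \<in> S r"
    then obtain u where u: "c t = c u" "u \<in> {t \<in> p ` \<Lambda>. r \<le> t}" unfolding S_def by (rule imageE)
    then have "u \<in> p ` \<Lambda>" "r \<le> u" by simp_all
    moreover have "t = u" using c(2)[OF that] c(2)[OF \<open>u \<in> p ` \<Lambda>\<close>] unfolding u(1) by (rule trans[OF sym])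
    ultimately show "r \<le> t" by simp
  qed (use that in \<open>simp add: S_def\<close>)
  have "inj_on S (p ` \<Lambda>)"
    by (rule inj_onI) (metis mem order_refl order_antisym)
  then have "infinite (S ` p ` \<Lambda>)" using inf finite_imageD by blast
  moreover have "T \<subseteq> \<Lambda>" if "T \<in> S ` p ` \<Lambda>" for T
    using that c(1) by (auto simp: S_def)
  ultimately show ?thesis
  proof (rule ent_gen_shift_free_sets[OF bij ab])
    fix T U m assume "T \<in> S ` p ` \<Lambda>" "U \<in> S ` p ` \<Lambda>"
      and eq: "\<And>i. i \<in> \<Lambda> \<Longrightarrow> (\<psi> ^^ m) i \<in> T \<longleftrightarrow> i \<in> U"
    then obtain r s where rs: "T = S r" "U = S s" by blast
    show "m = 0"
    proof (rule ccontr)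
      assume m: "m \<noteq> 0"
      obtain t where t: "t \<in> p ` \<Lambda>" "t > max m s"
        using inf unfolding infinite_nat_iff_unbounded by blast
      have "(\<psi> ^^ m) (c t) \<in> S r" using eq[OF c(1)[OF t(1)]] mem[OF t(1)] t(2) rs by simp
      then obtain t' where t': "t' \<in> p ` \<Lambda>" "(\<psi> ^^ m) (c t) = c t'" by (auto simp: S_def)
      have "t = t'" using p_inv[OF c(1)[OF t(1)], of m] c(2)[OF t(1)] c(2)[OF t'(1)] t'(2) by simp
      then have "(\<psi> ^^ m) (c t) = c t" using t'(2) by simp
      then have "t \<le> m" using p_le[of m "c t"] m c(2)[OF t(1)] by simp
      then show False using t(2) by simp
    qed
  qed
qed

lemma ent_gen_shift_inj:
  assumes psi: "\<psi> \<in> \<Lambda> \<rightarrow> \<Lambda>" and inj: "inj_on \<psi> \<Lambda>" and ab: "a \<in> X" "b \<in> X" "a \<noteq> b"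
    and fin: "finite_fibre (\<Lambda> \<rightarrow>\<^sub>E X) (gen_shift \<Lambda> \<psi>)"
  shows "ent_cset_onto (\<Lambda> \<rightarrow>\<^sub>E X) (gen_shift \<Lambda> \<psi>)
           = (if \<exists>n\<ge>1. \<forall>i\<in>\<Lambda>. (\<psi> ^^ n) i = i then 0 else \<infinity>)"
proof (cases "\<exists>n\<ge>1. \<forall>i\<in>\<Lambda>. (\<psi> ^^ n) i = i")
  case True
  then obtain n where n: "n \<ge> 1" "\<And>i. i \<in> \<Lambda> \<Longrightarrow> (\<psi> ^^ n) i = i" by blast
  have "(gen_shift \<Lambda> \<psi> ^^ n) x = x" if x: "x \<in> \<Lambda> \<rightarrow>\<^sub>E X" for x
    unfolding gen_shift_funpow[OF psi x] using x n(2)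
    by (auto simp: fun_eq_iff PiE_iff extensional_def)
  then show ?thesis using True ent_cset_onto_periodic[OF n(1)] by auto
next
  case ord: False
  have "ent_cset_onto (\<Lambda> \<rightarrow>\<^sub>E X) (gen_shift \<Lambda> \<psi>) = \<infinity>"
  proof (cases "\<psi> ` \<Lambda> = \<Lambda>")
    case False
    then show ?thesis using ent_gen_shift_not_onto[OF psi inj _ ab fin] by blast
  next
    case True
    then have bij: "bij_betw \<psi> \<Lambda> \<Lambda>" using inj by (simp add: bij_betw_def)
    show ?thesis
    proof (cases "\<exists>c\<in>\<Lambda>. inj (\<lambda>n. (\<psi> ^^ n) c)")
      case True
      then show ?thesis using ent_gen_shift_infinite_orbit[OF bij ab] by blast
    next
      case False
      have "\<exists>n\<ge>1. (\<psi> ^^ n) i = i" if i: "i \<in> \<Lambda>" for i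
      proof -
        obtain k l where kl: "k < l" "(\<psi> ^^ k) i = (\<psi> ^^ l) i"
          using False i unfolding inj_def by (metis nat_neq_iff)
        have "(\<psi> ^^ k) ((\<psi> ^^ (l - k)) i) = (\<psi> ^^ (k + (l - k))) i" by (simp only: funpow_add o_def)
        then have "(\<psi> ^^ k) ((\<psi> ^^ (l - k)) i) = (\<psi> ^^ k) i" using kl by simp
        moreover have "inj_on (\<psi> ^^ k) \<Lambda>" using bij_betw_funpow[OF bij] by (simp add: bij_betw_def)
        ultimately have "(\<psi> ^^ (l - k)) i = i"
          using funpow_closed[OF psi i] i by (meson inj_onD)
        then show ?thesis using kl(1) by (intro exI[of _ "l - k"]) auto
      qed
      then show ?thesis using ent_gen_shift_unbounded_periods[OF bij ab] ord by blast
    qed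
  qed
  then show ?thesis using ord by simp
qed

section \<open>The surjective cover and the quotient\<close>

lemma surj_cover_onto:
  assumes "k ` A = A"
  shows "surj_cover A k = A"
  using funpow_image[OF assms] by (auto simp: surj_cover_def)

lemma quot_map_closed:
  assumes phi: "\<phi> \<in> \<Gamma> \<rightarrow> \<Gamma>"
  shows "quot_map \<Gamma> \<phi> \<in> \<Gamma> // shift_rel \<Gamma> \<phi> \<rightarrow> \<Gamma> // shift_rel \<Gamma> \<phi>"
proof
  fix C assume "C \<in> \<Gamma> // shift_rel \<Gamma> \<phi>"
  then obtain \<alpha> where "\<alpha> \<in> \<Gamma>" "C = shift_rel \<Gamma> \<phi> `` {\<alpha>}" by (rule quotientE)
  then show "quot_map \<Gamma> \<phi> C \<in> \<Gamma> // shift_rel \<Gamma> \<phi>"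
    using phi by (auto simp: quot_map_class intro: quotientI)
qed

lemma inj_on_quot_map:
  assumes phi: "\<phi> \<in> \<Gamma> \<rightarrow> \<Gamma>"
  shows "inj_on (quot_map \<Gamma> \<phi>) (\<Gamma> // shift_rel \<Gamma> \<phi>)"
proof (rule inj_onI)
  let ?c = "\<lambda>\<alpha>. shift_rel \<Gamma> \<phi> `` {\<alpha>}"
  fix C D assume "C \<in> \<Gamma> // shift_rel \<Gamma> \<phi>" "D \<in> \<Gamma> // shift_rel \<Gamma> \<phi>"
    and eq: "quot_map \<Gamma> \<phi> C = quot_map \<Gamma> \<phi> D"
  then obtain \<alpha> \<beta> where ab: "\<alpha> \<in> \<Gamma>" "C = ?c \<alpha>" "\<beta> \<in> \<Gamma>" "D = ?c \<beta>" by (meson quotientE)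
  have "?c (\<phi> \<alpha>) = ?c (\<phi> \<beta>)" using eq ab by (simp add: quot_map_class[OF phi])
  then have "(\<phi> \<alpha>, \<phi> \<beta>) \<in> shift_rel \<Gamma> \<phi>"
    using eq_equiv_class_iff[OF equiv_shift_rel, of "\<phi> \<alpha>" \<Gamma> "\<phi> \<beta>" \<phi>] phi ab by auto
  then obtain n where "(\<phi> ^^ n) (\<phi> \<alpha>) = (\<phi> ^^ n) (\<phi> \<beta>)" by (auto simp: shift_rel_def)
  then have "(\<phi> ^^ Suc n) \<alpha> = (\<phi> ^^ Suc n) \<beta>"
    by (simp add: funpow_Suc_right del: funpow.simps)
  then have "(\<alpha>, \<beta>) \<in> shift_rel \<Gamma> \<phi>"
    using ab unfolding shift_rel_def by (auto intro!: exI[of _ "Suc n"] simp del: funpow.simps)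
  then show "C = D" using ab equiv_class_eq[OF equiv_shift_rel] by metis
qed

definition class_pullback :: "'i set \<Rightarrow> ('i \<Rightarrow> 'i) \<Rightarrow> ('i set \<Rightarrow> 'x) \<Rightarrow> ('i \<Rightarrow> 'x)" where
  "class_pullback \<Gamma> \<phi> y = (\<lambda>\<alpha>\<in>\<Gamma>. y (shift_rel \<Gamma> \<phi> `` {\<alpha>}))"

lemma class_pullback_closed:
  assumes "y \<in> \<Gamma> // shift_rel \<Gamma> \<phi> \<rightarrow>\<^sub>E X"
  shows "class_pullback \<Gamma> \<phi> y \<in> \<Gamma> \<rightarrow>\<^sub>E X"
  using assms by (auto simp: class_pullback_def quotientI dest!: PiE_mem)

lemma inj_on_class_pullback: "inj_on (class_pullback \<Gamma> \<phi>) (\<Gamma> // shift_rel \<Gamma> \<phi> \<rightarrow>\<^sub>E X)"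
proof (rule inj_onI)
  fix y z assume y: "y \<in> \<Gamma> // shift_rel \<Gamma> \<phi> \<rightarrow>\<^sub>E X" and z: "z \<in> \<Gamma> // shift_rel \<Gamma> \<phi> \<rightarrow>\<^sub>E X"
    and eq: "class_pullback \<Gamma> \<phi> y = class_pullback \<Gamma> \<phi> z"
  show "y = z"
  proof (rule PiE_ext[OF y z])
    fix C assume "C \<in> \<Gamma> // shift_rel \<Gamma> \<phi>"
    then obtain \<alpha> where "\<alpha> \<in> \<Gamma>" "C = shift_rel \<Gamma> \<phi> `` {\<alpha>}" by (rule quotientE)
    then show "y C = z C" using fun_cong[OF eq, of \<alpha>] by (simp add: class_pullback_def)
  qed
qed

lemma class_pullback_gen_shift:
  assumes "\<phi> \<in> \<Gamma> \<rightarrow> \<Gamma>"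
  shows "class_pullback \<Gamma> \<phi> (gen_shift (\<Gamma> // shift_rel \<Gamma> \<phi>) (quot_map \<Gamma> \<phi>) y)
           = gen_shift \<Gamma> \<phi> (class_pullback \<Gamma> \<phi> y)"
  using assms by (auto simp: class_pullback_def gen_shift_def quot_map_class quotientI fun_eq_iff)

text \<open>
  A pullback has preimages of all orders because the quotient shift is onto and commutes with
  pulling back. Conversely, if \<open>\<phi>\<^sup>n \<alpha> = \<phi>\<^sup>n \<beta>\<close>, then the coordinates at \<open>\<alpha>\<close> and \<open>\<beta>\<close> agree in every
  element of the image of the \<open>n\<close>-th iterate, so an element of the surjective cover is constant on
  classes.
\<close>

lemma surj_cover_gen_shift:
  assumes phi: "\<phi> \<in> \<Gamma> \<rightarrow> \<Gamma>" and "X \<noteq> {}"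
  shows "surj_cover (\<Gamma> \<rightarrow>\<^sub>E X) (gen_shift \<Gamma> \<phi>)
           = class_pullback \<Gamma> \<phi> ` (\<Gamma> // shift_rel \<Gamma> \<phi> \<rightarrow>\<^sub>E X)"
    (is "?S = ?L ` ?Y")
proof
  let ?c = "\<lambda>\<alpha>. shift_rel \<Gamma> \<phi> `` {\<alpha>}"
  let ?h = "gen_shift (\<Gamma> // shift_rel \<Gamma> \<phi>) (quot_map \<Gamma> \<phi>)"
  have onto: "?h ` ?Y = ?Y"
    by (rule gen_shift_onto[OF quot_map_closed[OF phi] inj_on_quot_map[OF phi] \<open>X \<noteq> {}\<close>])
  show "?L ` ?Y \<subseteq> ?S"
  proof
    fix x assume "x \<in> ?L ` ?Y"
    then obtain y where y: "y \<in> ?Y" "x = ?L y" by blast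
    have comm: "?L ((?h ^^ n) z) = (gen_shift \<Gamma> \<phi> ^^ n) (?L z)" for n z
      by (induction n) (simp_all add: class_pullback_gen_shift[OF phi])
    have "x \<in> (gen_shift \<Gamma> \<phi> ^^ n) ` (\<Gamma> \<rightarrow>\<^sub>E X)" for n
    proof -
      have "y \<in> (?h ^^ n) ` ?Y" unfolding funpow_image[OF onto] by (rule y(1))
      then obtain z where z: "z \<in> ?Y" "y = (?h ^^ n) z" by (rule imageE) simp
      have "x = (gen_shift \<Gamma> \<phi> ^^ n) (?L z)" unfolding y(2) z(2) by (rule comm)
      then show ?thesis using class_pullback_closed[OF z(1)] by blast
    qed
    then show "x \<in> ?S" by (simp add: surj_cover_def)
  qed
  show "?S \<subseteq> ?L ` ?Y"
  proof
    fix x assume x: "x \<in> ?S"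
    then have img: "x \<in> (gen_shift \<Gamma> \<phi> ^^ n) ` (\<Gamma> \<rightarrow>\<^sub>E X)" if "n \<ge> 1" for n
      using that by (simp add: surj_cover_def)
    have xin: "x \<in> \<Gamma> \<rightarrow>\<^sub>E X"
      using img[of 1] gen_shift_closed[OF phi, of X] by auto
    have const: "x \<alpha> = x \<beta>" if rel: "(\<alpha>, \<beta>) \<in> shift_rel \<Gamma> \<phi>" for \<alpha> \<beta>
    proof -
      obtain n where n: "n \<ge> 1" "(\<phi> ^^ n) \<alpha> = (\<phi> ^^ n) \<beta>" and ab: "\<alpha> \<in> \<Gamma>" "\<beta> \<in> \<Gamma>"
        using rel by (auto simp: shift_rel_def)
      obtain z where z: "z \<in> \<Gamma> \<rightarrow>\<^sub>E X" "x = (gen_shift \<Gamma> \<phi> ^^ n) z" using img[OF n(1)] by blast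
      show ?thesis using ab n(2) by (simp add: z(2) gen_shift_funpow[OF phi z(1)])
    qed
    define y where "y = (\<lambda>C\<in>\<Gamma> // shift_rel \<Gamma> \<phi>. x (SOME \<alpha>. \<alpha> \<in> C))"
    have y_class: "y (?c \<alpha>) = x \<alpha>" if "\<alpha> \<in> \<Gamma>" for \<alpha>
    proof -
      have "\<alpha> \<in> ?c \<alpha>" using that by (rule equiv_class_self[OF equiv_shift_rel])
      then have "(SOME \<beta>. \<beta> \<in> ?c \<alpha>) \<in> ?c \<alpha>" by (rule someI)
      then show ?thesis using const that by (auto simp: y_def quotientI)
    qed
    have "y \<in> ?Y"
    proof
      fix C assume "C \<in> \<Gamma> // shift_rel \<Gamma> \<phi>"
      then obtain \<alpha> where "\<alpha> \<in> \<Gamma>" "C = ?c \<alpha>" by (rule quotientE)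
      then show "y C \<in> X" using y_class xin by auto
    qed (simp add: y_def)
    moreover have "?L y = x"
      using y_class xin by (auto simp: class_pullback_def fun_eq_iff PiE_iff extensional_def)
    ultimately show "x \<in> ?L ` ?Y" by blast
  qed
qed

theorem corollary3p9:
  fixes X :: "'x set" and \<Gamma> :: "'i set" and \<phi> :: "'i \<Rightarrow> 'i"
  assumes "\<exists>a\<in>X. \<exists>b\<in>X. a \<noteq> b"
    and "\<Gamma> \<noteq> {}"
    and "\<phi> \<in> \<Gamma> \<rightarrow> \<Gamma>"
    and "finite_fibre (\<Gamma> \<rightarrow>\<^sub>E X) (gen_shift \<Gamma> \<phi>)"
  shows "ent_cset (\<Gamma> \<rightarrow>\<^sub>E X) (gen_shift \<Gamma> \<phi>)
           = ent_cset ((\<Gamma> // shift_rel \<Gamma> \<phi>) \<rightarrow>\<^sub>E X) (gen_shift (\<Gamma> // shift_rel \<Gamma> \<phi>) (quot_map \<Gamma> \<phi>))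
       \<and> ent_cset ((\<Gamma> // shift_rel \<Gamma> \<phi>) \<rightarrow>\<^sub>E X) (gen_shift (\<Gamma> // shift_rel \<Gamma> \<phi>) (quot_map \<Gamma> \<phi>))
           = (if \<exists>n\<ge>1. \<forall>C \<in> \<Gamma> // shift_rel \<Gamma> \<phi>. (quot_map \<Gamma> \<phi> ^^ n) C = C then 0 else \<infinity>)"
proof -
  let ?Y = "\<Gamma> // shift_rel \<Gamma> \<phi> \<rightarrow>\<^sub>E X"
  let ?h = "gen_shift (\<Gamma> // shift_rel \<Gamma> \<phi>) (quot_map \<Gamma> \<phi>)"
  note phi = assms(3)
  note closed = quot_map_closed[OF phi] and inj = inj_on_quot_map[OF phi]
  obtain a b where ab: "a \<in> X" "b \<in> X" "a \<noteq> b" using assms(1) by blast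
  then have "X \<noteq> {}" by blast
  have quot: "ent_cset ?Y ?h = ent_cset_onto ?Y ?h"
    unfolding ent_cset_def surj_cover_onto[OF gen_shift_onto[OF closed inj \<open>X \<noteq> {}\<close>]] ..
  have "ent_cset_onto ?Y ?h
      = ent_cset_onto (class_pullback \<Gamma> \<phi> ` ?Y) (gen_shift \<Gamma> \<phi>)"
    by (rule ent_cset_onto_conjugate[where L = "class_pullback \<Gamma> \<phi>"])
      (simp_all add: bij_betw_def inj_on_class_pullback gen_shift_closed[OF closed]
        class_pullback_gen_shift[OF phi])
  then have "ent_cset (\<Gamma> \<rightarrow>\<^sub>E X) (gen_shift \<Gamma> \<phi>) = ent_cset ?Y ?h"
    unfolding quot ent_cset_def[of "\<Gamma> \<rightarrow>\<^sub>E X"] surj_cover_gen_shift[OF phi \<open>X \<noteq> {}\<close>] by simp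
  moreover have "ent_cset ?Y ?h
      = (if \<exists>n\<ge>1. \<forall>C \<in> \<Gamma> // shift_rel \<Gamma> \<phi>. (quot_map \<Gamma> \<phi> ^^ n) C = C then 0 else \<infinity>)"
    unfolding quot
    by (rule ent_gen_shift_inj[OF closed inj ab finite_fibre_quot_shift[OF phi assms(4)]])
  ultimately show ?thesis by blast
qed

end
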